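(* Let $L$ be a symmetric Latin square of order $n$ and let $\Gamma$ be its rrs-autotopism group. Then the number of isomorphism classes that contain a reduced symmetric Latin square rrs-isotopic to $L$ equals \[\frac{1}{|\Gamma|}\sum_{(\alpha,\alpha,\beta)\in\Gamma}\lambda(\alpha,\beta),\] where $\lambda(\alpha,\beta)$ is the number of fixed points of $\alpha$ if $\alpha$ and $\beta$ have the same cycle structure, and $\lambda(\alpha,\beta)=0$ otherwise.
   Context: A Latin square of order $n$ is a set of $n^2$ triples (row, column, symbol) over $\{1,\dots,n\}$, distinct triples agreeing in at most one coordinate; it is symmetric if it equals its transpose, and reduced if its first row and first column are $1,2,\dots,n$ in order. An isotopism $(\alpha,\beta,\gamma)\in\mathcal{S}_n^3$ maps $(r,c,s)$ to $(r^\alpha,c^\beta,s^\gamma)$; it is an rrs-isotopism if $\alpha=\beta$ and an isomorphism if $\alpha=\beta=\gamma$. The rrs-autotopism group of $L$ is the group of rrs-isotopisms mapping $L$ to itself. *)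

theory Defs
  imports Complex_Main "HOL-Library.Multiset" "HOL-Combinatorics.Orbits"
begin

type_synonym triple = "nat \<times> nat \<times> nat"
type_synonym perm3 = "(nat \<Rightarrow> nat) \<times> (nat \<Rightarrow> nat) \<times> (nat \<Rightarrow> nat)"

definition latin_square :: "nat \<Rightarrow> triple set \<Rightarrow> bool" where
  "latin_square n L \<longleftrightarrow>
     L \<subseteq> {1..n} \<times> {1..n} \<times> {1..n} \<and> card L = n ^ 2 \<and>
     (\<forall>(r, c, s) \<in> L. \<forall>(r', c', s') \<in> L. (r, c, s) \<noteq> (r', c', s') \<longrightarrow>
        \<not> (r = r' \<and> c = c') \<and> \<not> (r = r' \<and> s = s') \<and> \<not> (c = c' \<and> s = s'))"

definition transpose_square :: "triple set \<Rightarrow> triple set" where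
  "transpose_square L = (\<lambda>(r, c, s). (c, r, s)) ` L"

definition symmetric_square :: "triple set \<Rightarrow> bool" where
  "symmetric_square L \<longleftrightarrow> transpose_square L = L"

definition reduced_square :: "nat \<Rightarrow> triple set \<Rightarrow> bool" where
  "reduced_square n L \<longleftrightarrow> (\<forall>i \<in> {1..n}. (1, i, i) \<in> L \<and> (i, 1, i) \<in> L)"

text \<open>Elements of the symmetric group on \<open>{1..n}\<close> are functions on \<^typ>\<open>nat\<close> that permute
  \<open>{1..n}\<close> and fix everything else, so each permutation has exactly one representation.\<close>

definition isotopisms :: "nat \<Rightarrow> perm3 set" where
  "isotopisms n = {(\<alpha>, \<beta>, \<gamma>). \<alpha> permutes {1..n} \<and> \<beta> permutes {1..n} \<and> \<gamma> permutes {1..n}}"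

definition rrs_isotopisms :: "nat \<Rightarrow> perm3 set" where
  "rrs_isotopisms n = {(\<alpha>, \<beta>, \<gamma>) \<in> isotopisms n. \<alpha> = \<beta>}"

definition isomorphisms :: "nat \<Rightarrow> perm3 set" where
  "isomorphisms n = {(\<alpha>, \<beta>, \<gamma>) \<in> isotopisms n. \<alpha> = \<beta> \<and> \<beta> = \<gamma>}"

fun apply_isotopism :: "perm3 \<Rightarrow> triple set \<Rightarrow> triple set" where
  "apply_isotopism (\<alpha>, \<beta>, \<gamma>) L = (\<lambda>(r, c, s). (\<alpha> r, \<beta> c, \<gamma> s)) ` L"

definition rrs_isotopic :: "nat \<Rightarrow> triple set \<Rightarrow> triple set \<Rightarrow> bool" where
  "rrs_isotopic n L M \<longleftrightarrow> (\<exists>\<theta> \<in> rrs_isotopisms n. apply_isotopism \<theta> L = M)"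

definition isomorphism_rel :: "nat \<Rightarrow> (triple set \<times> triple set) set" where
  "isomorphism_rel n = {(L, M). latin_square n L \<and> latin_square n M \<and>
     (\<exists>\<theta> \<in> isomorphisms n. apply_isotopism \<theta> L = M)}"

definition isomorphism_classes :: "nat \<Rightarrow> triple set set set" where
  "isomorphism_classes n = {L. latin_square n L} // isomorphism_rel n"

definition rrs_autotopism_group :: "nat \<Rightarrow> triple set \<Rightarrow> perm3 set" where
  "rrs_autotopism_group n L = {\<theta> \<in> rrs_isotopisms n. apply_isotopism \<theta> L = L}"

text \<open>The multiset of cycle lengths, with fixed points in \<open>{1..n}\<close> counted as cycles of length 1.\<close>

definition cycle_structure :: "nat \<Rightarrow> (nat \<Rightarrow> nat) \<Rightarrow> nat multiset" where
  "cycle_structure n \<alpha> = image_mset card (mset_set (orbit \<alpha> ` {1..n}))"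

definition lambda_count :: "nat \<Rightarrow> (nat \<Rightarrow> nat) \<Rightarrow> (nat \<Rightarrow> nat) \<Rightarrow> nat" where
  "lambda_count n \<alpha> \<beta> =
     (if cycle_structure n \<alpha> = cycle_structure n \<beta> then card {i \<in> {1..n}. \<alpha> i = i} else 0)"

end

theory Submission
  imports Defs "HOL-Algebra.Group_Action"
begin

text \<open>
  Let \<open>row e\<close> be the permutation of \<open>{1..n}\<close> in row \<open>e\<close> of \<open>L\<close>, and let \<open>loop e\<close> be the image of
  \<open>L\<close> under \<open>(id, id, (row e)\<^sup>-\<^sup>1)\<close>, the only isotope of this shape with identity element \<open>e\<close>.
  If \<open>M\<close> is reduced and \<open>M = (\<alpha>, \<alpha>, \<beta>) L\<close>, then \<open>\<alpha>\<close> is an isomorphism from \<open>loop (\<alpha>\<^sup>-\<^sup>1 1)\<close> to \<open>M\<close>;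
  so the classes in question are those of the squares \<open>loop e\<close>. An isomorphism from \<open>loop e\<close> to
  \<open>loop f\<close> maps \<open>e\<close> to \<open>f\<close>, and the isomorphisms \<open>\<alpha>\<close> from \<open>loop e\<close> to \<open>loop f\<close> are exactly the
  permutations with \<open>\<alpha> e = f\<close> and \<open>(\<alpha>, \<alpha>, \<beta>) \<in> \<Gamma>\<close> for some \<open>\<beta>\<close>. Hence the number of classes is the
  number of orbits of \<open>\<Gamma>\<close> on \<open>{1..n}\<close>, and Burnside's lemma applies. The cycle structure condition
  costs nothing: if \<open>\<alpha>\<close> fixes \<open>e\<close>, then \<open>\<beta>\<close> is the conjugate of \<open>\<alpha>\<close> by \<open>row e\<close>.
\<close>

section \<open>Orbit counting and conjugate permutations\<close>

unbundle no m_inv_syntax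

text \<open>A set of permutations containing \<open>id\<close> and closed under composition and
  inverses is a group acting on \<open>S\<close> by evaluation, so orbit counting in
  \<open>HOL-Algebra\<close> applies. Orbits are written as plain images, the form in which they are
  compared with isomorphism classes later.\<close>

lemma burnside_permutations:
  assumes fin: "finite S"
    and perm: "\<And>a. a \<in> A \<Longrightarrow> a permutes S"
    and id: "id \<in> A"
    and comp: "\<And>a b. a \<in> A \<Longrightarrow> b \<in> A \<Longrightarrow> a \<circ> b \<in> A"
    and inv: "\<And>a. a \<in> A \<Longrightarrow> inv a \<in> A"
  shows "card ((\<lambda>x. (\<lambda>a. a x) ` A) ` S) * card A = (\<Sum>a\<in>A. card {x \<in> S. a x = x})"
proof -
  define G :: "('a \<Rightarrow> 'a) monoid" where "G = \<lparr>carrier = A, mult = (\<circ>), one = id\<rparr>"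
  \<comment> \<open>Elements of \<open>BijGroup S\<close> are \<open>undefined\<close> off
    \<open>S\<close>, whereas permutations are the identity there; \<open>restrict\<close> passes
    from one convention to the other.\<close>
  define \<phi> where "\<phi> = (\<lambda>a::'a \<Rightarrow> 'a. restrict a S)"
  have G: "group G"
  proof (rule groupI)
    fix a assume "a \<in> carrier G"
    then show "\<exists>b\<in>carrier G. b \<otimes>\<^bsub>G\<^esub> a = \<one>\<^bsub>G\<^esub>"
      using inv permutes_inv_o(2)[OF perm] by (auto simp: G_def)
  qed (auto simp: G_def id comp o_assoc)
  have Bij: "\<phi> a \<in> Bij S" if "a \<in> A" for a
    using permutes_imp_bij[OF perm[OF that]] by (auto simp: \<phi>_def Bij_def cong: bij_betw_cong)
  have hom: "\<phi> \<in> hom G (BijGroup S)"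
  proof (rule homI)
    fix a b assume "a \<in> carrier G" "b \<in> carrier G"
    then have ab: "a \<in> A" "b \<in> A" by (auto simp: G_def)
    then show "\<phi> (a \<otimes>\<^bsub>G\<^esub> b) = \<phi> a \<otimes>\<^bsub>BijGroup S\<^esub> \<phi> b"
      using Bij permutes_in_image[OF perm[OF ab(2)]]
      by (auto simp: G_def BijGroup_def compose_def \<phi>_def restrict_def)
  qed (use Bij in \<open>auto simp: G_def BijGroup_def\<close>)
  interpret group_action G S \<phi>
    by (intro group_action.intro group_hom.intro group_hom_axioms.intro G group_BijGroup hom)
  have "finite A"
    using finite_subset[OF _ finite_permutations[OF fin]] perm by blast
  then have "card (orbits G S \<phi>) * card A = (\<Sum>a\<in>A. card (invariants S \<phi> a))"
    using burnside fin by (simp add: G_def order_def)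
  moreover have "orbits G S \<phi> = (\<lambda>x. (\<lambda>a. a x) ` A) ` S"
    by (auto simp: orbits_def Group_Action.orbit_def G_def \<phi>_def image_def)
  moreover have "invariants S \<phi> a = {x \<in> S. a x = x}" for a
    by (auto simp: invariants_def \<phi>_def)
  ultimately show ?thesis by simp
qed

text \<open>Sending \<open>f x\<close> to \<open>g x\<close> is well defined and injective, since
  each side of the kernel condition implies the other. It serves to match isomorphism classes with
  orbits through their common index \<open>e\<close>.\<close>

lemma card_image_eq_if_same_kernel:
  assumes "\<And>x y. x \<in> S \<Longrightarrow> y \<in> S \<Longrightarrow> f x = f y \<longleftrightarrow> g x = g y"
  shows "card (f ` S) = card (g ` S)"
proof -
  have "g (inv_into S f (f x)) = g x" if "x \<in> S" for x
    using that assms by (metis f_inv_into_f imageI inv_into_into)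
  then have "g ` S = (\<lambda>z. g (inv_into S f z)) ` f ` S"
    by (auto simp: image_image cong: image_cong)
  moreover have "inj_on (\<lambda>z. g (inv_into S f z)) (f ` S)"
  proof (rule inj_onI)
    fix z w assume zw: "z \<in> f ` S" "w \<in> f ` S" "g (inv_into S f z) = g (inv_into S f w)"
    then have "f (inv_into S f z) = f (inv_into S f w)"
      by (simp only: assms inv_into_into)
    with zw show "z = w" by (simp add: f_inv_into_f)
  qed
  ultimately show ?thesis
    by (simp add: card_image)
qed

text \<open>Since \<open>b\<close> is the conjugate of \<open>a\<close> by \<open>s\<close>, the map
  \<open>s\<close> carries cycles of \<open>a\<close> onto cycles of \<open>b\<close>. Injectivity
  of \<open>s\<close> preserves their lengths and keeps distinct cycles distinct.\<close>

lemma cycle_structure_conj: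
  assumes s: "s permutes {1..n}" and a: "a permutes {1..n}" and eq: "b \<circ> s = s \<circ> a"
  shows "cycle_structure n b = cycle_structure n a"
proof -
  have inj: "inj s" using s by (rule permutes_inj)
  \<comment> \<open>\<open>orbit\<close> is generated from \<open>a x\<close> onwards; that
    \<open>x\<close> itself belongs to it comes from the finite support of \<open>a\<close>.\<close>
  have "permutation a" using a permutation_permutes by blast
  then have orb: "s ` Orbits.orbit a x = Orbits.orbit b (s x)" for x
    by (intro orbit_inverse permutation_self_in_orbit) (use eq in \<open>auto simp: fun_eq_iff\<close>)
  have "Orbits.orbit b ` {1..n} = Orbits.orbit b ` s ` {1..n}"
    using permutes_image[OF s] by simp
  also have "\<dots> = image s ` Orbits.orbit a ` {1..n}"
    by (simp add: image_image orb)
  finally have "mset_set (Orbits.orbit b ` {1..n})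
      = image_mset (image s) (mset_set (Orbits.orbit a ` {1..n}))"
    using inj by (simp add: image_mset_mset_set inj_on_def inj_image_eq_iff)
  then show ?thesis
    using inj by (simp add: cycle_structure_def multiset.map_comp o_def card_image inj_on_subset)
qed

section \<open>The action of isotopisms on Latin squares\<close>

lemma apply_isotopism_comp:
  "apply_isotopism (a, b, c) (apply_isotopism (a', b', c') L)
    = apply_isotopism (a \<circ> a', b \<circ> b', c \<circ> c') L"
  by (auto simp: image_image case_prod_beta)

lemma apply_isotopism_id [simp]: "apply_isotopism (id, id, id) L = L"
  by auto

lemma apply_isotopism_memI: "(r, c, s) \<in> L \<Longrightarrow> (\<alpha> r, \<beta> c, \<gamma> s) \<in> apply_isotopism (\<alpha>, \<beta>, \<gamma>) L"
  by force

lemma apply_isotopism_eq_iff: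
  assumes "a permutes S" "b permutes T" "c permutes U"
  shows "apply_isotopism (a, b, c) L = M \<longleftrightarrow> L = apply_isotopism (inv a, inv b, inv c) M"
proof -
  have "apply_isotopism (a, b, c) (apply_isotopism (inv a, inv b, inv c) M) = M" for M
    unfolding apply_isotopism_comp permutes_inv_o(1)[OF assms(1)] permutes_inv_o(1)[OF assms(2)]
      permutes_inv_o(1)[OF assms(3)] by (rule apply_isotopism_id)
  moreover have "apply_isotopism (inv a, inv b, inv c) (apply_isotopism (a, b, c) M) = M" for M
    unfolding apply_isotopism_comp permutes_inv_o(2)[OF assms(1)] permutes_inv_o(2)[OF assms(2)]
      permutes_inv_o(2)[OF assms(3)] by (rule apply_isotopism_id)
  ultimately show ?thesis by metis
qed

text \<open>Contraposed, the Latin condition becomes a rule deriving equality of triples, which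
  injective coordinate maps transport directly.\<close>

lemma latin_square_iff:
  "latin_square n L \<longleftrightarrow> L \<subseteq> {1..n} \<times> {1..n} \<times> {1..n} \<and> card L = n\<^sup>2 \<and>
    (\<forall>r c s r' c' s'. (r, c, s) \<in> L \<longrightarrow> (r', c', s') \<in> L \<longrightarrow>
      r = r' \<and> c = c' \<or> r = r' \<and> s = s' \<or> c = c' \<and> s = s' \<longrightarrow> (r, c, s) = (r', c', s'))"
  unfolding latin_square_def Ball_def split_paired_All case_prod_conv
  by (intro conj_cong refl) (intro iffI allI impI; metis)

lemma latin_squareD:
  assumes "latin_square n L" "(r, c, s) \<in> L" "(r', c', s') \<in> L"
  shows "r = r' \<Longrightarrow> c = c' \<Longrightarrow> s = s'" "r = r' \<Longrightarrow> s = s' \<Longrightarrow> c = c'" "c = c' \<Longrightarrow> s = s' \<Longrightarrow> r = r'"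
proof -
  have "r = r' \<and> c = c' \<or> r = r' \<and> s = s' \<or> c = c' \<and> s = s' \<longrightarrow> (r, c, s) = (r', c', s')"
    using assms unfolding latin_square_iff by blast
  then show "r = r' \<Longrightarrow> c = c' \<Longrightarrow> s = s'" "r = r' \<Longrightarrow> s = s' \<Longrightarrow> c = c'" "c = c' \<Longrightarrow> s = s' \<Longrightarrow> r = r'"
    by simp_all
qed

lemma latin_square_apply_isotopism:
  assumes L: "latin_square n L"
    and perm: "\<alpha> permutes {1..n}" "\<beta> permutes {1..n}" "\<gamma> permutes {1..n}"
  shows "latin_square n (apply_isotopism (\<alpha>, \<beta>, \<gamma>) L)"
  unfolding latin_square_iff
proof (intro conjI allI impI)
  have inj: "inj \<alpha>" "inj \<beta>" "inj \<gamma>" using perm by (auto intro: permutes_inj)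
  then have "inj_on (\<lambda>(r, c, s). (\<alpha> r, \<beta> c, \<gamma> s)) L"
    by (intro inj_onI) (clarsimp simp: inj_eq)
  then show "card (apply_isotopism (\<alpha>, \<beta>, \<gamma>) L) = n\<^sup>2"
    using L by (simp add: card_image latin_square_iff)
  have "(\<alpha> r, \<beta> c, \<gamma> s) \<in> {1..n} \<times> {1..n} \<times> {1..n}" if "(r, c, s) \<in> L" for r c s
  proof -
    have "r \<in> {1..n}" "c \<in> {1..n}" "s \<in> {1..n}"
      using L that unfolding latin_square_iff by blast+
    then show ?thesis
      using perm by (simp only: mem_Sigma_iff permutes_in_image)
  qed
  then show "apply_isotopism (\<alpha>, \<beta>, \<gamma>) L \<subseteq> {1..n} \<times> {1..n} \<times> {1..n}" by auto
  fix r c s r' c' s'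
  assume "(r, c, s) \<in> apply_isotopism (\<alpha>, \<beta>, \<gamma>) L" "(r', c', s') \<in> apply_isotopism (\<alpha>, \<beta>, \<gamma>) L"
  then obtain x y z x' y' z' where L': "(x, y, z) \<in> L" "(x', y', z') \<in> L"
    and eq: "r = \<alpha> x" "c = \<beta> y" "s = \<gamma> z" "r' = \<alpha> x'" "c' = \<beta> y'" "s' = \<gamma> z'"
    by auto
  assume "r = r' \<and> c = c' \<or> r = r' \<and> s = s' \<or> c = c' \<and> s = s'"
  then have "x = x' \<and> y = y' \<or> x = x' \<and> z = z' \<or> y = y' \<and> z = z'"
    by (simp add: eq inj_eq inj)
  then show "(r, c, s) = (r', c', s')"
    using latin_squareD[OF L L'] by (auto simp: eq)
qed

lemma symmetric_square_iff: "symmetric_square L \<longleftrightarrow> (\<forall>r c s. (r, c, s) \<in> L \<longrightarrow> (c, r, s) \<in> L)"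
proof
  assume "\<forall>r c s. (r, c, s) \<in> L \<longrightarrow> (c, r, s) \<in> L"
  then show "symmetric_square L"
    unfolding symmetric_square_def transpose_square_def by force
next
  assume "symmetric_square L"
  then have L: "(\<lambda>(r, c, s). (c, r, s)) ` L = L"
    by (simp add: symmetric_square_def transpose_square_def)
  show "\<forall>r c s. (r, c, s) \<in> L \<longrightarrow> (c, r, s) \<in> L"
  proof (intro allI impI)
    fix r c s assume "(r, c, s) \<in> L"
    from imageI[OF this, of "\<lambda>(r, c, s). (c, r, s)"] show "(c, r, s) \<in> L"
      by (simp add: L)
  qed
qed

lemma symmetric_square_apply_isotopism:
  "symmetric_square L \<Longrightarrow> symmetric_square (apply_isotopism (\<alpha>, \<alpha>, \<beta>) L)"
  unfolding symmetric_square_iff by force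

declare apply_isotopism.simps [simp del]

section \<open>Isomorphism as an equivalence relation\<close>

lemma isomorphism_rel_iff:
  "(L, M) \<in> isomorphism_rel n \<longleftrightarrow>
    latin_square n L \<and> (\<exists>\<alpha>. \<alpha> permutes {1..n} \<and> apply_isotopism (\<alpha>, \<alpha>, \<alpha>) L = M)"
  by (auto simp: isomorphism_rel_def isomorphisms_def isotopisms_def
      intro: latin_square_apply_isotopism)

lemma equiv_isomorphism_rel: "equiv {L. latin_square n L} (isomorphism_rel n)"
proof (rule equivI)
  show "isomorphism_rel n \<subseteq> {L. latin_square n L} \<times> {L. latin_square n L}"
    by (auto simp: isomorphism_rel_def)
  show "refl_on {L. latin_square n L} (isomorphism_rel n)"
    using apply_isotopism_id permutes_id unfolding refl_on_def isomorphism_rel_iff by blast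
  show "sym (isomorphism_rel n)"
  proof (rule symI)
    fix L M assume LM: "(L, M) \<in> isomorphism_rel n"
    then obtain \<alpha> where "\<alpha> permutes {1..n}" "apply_isotopism (\<alpha>, \<alpha>, \<alpha>) L = M"
      by (auto simp: isomorphism_rel_iff)
    then have "inv \<alpha> permutes {1..n}" "apply_isotopism (inv \<alpha>, inv \<alpha>, inv \<alpha>) M = L"
      using apply_isotopism_eq_iff permutes_inv by metis+
    moreover have "latin_square n M" using LM by (simp add: isomorphism_rel_def)
    ultimately show "(M, L) \<in> isomorphism_rel n" by (auto simp: isomorphism_rel_iff)
  qed
  show "trans (isomorphism_rel n)"
  proof (rule transI)
    fix L M N assume "(L, M) \<in> isomorphism_rel n" "(M, N) \<in> isomorphism_rel n"
    then show "(L, N) \<in> isomorphism_rel n"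
      using apply_isotopism_comp permutes_compose unfolding isomorphism_rel_iff by metis
  qed
qed

section \<open>Rows and loops of a symmetric Latin square\<close>

locale symmetric_latin_square =
  fixes n :: nat and L :: "triple set"
  assumes latin: "latin_square n L" and symm: "symmetric_square L"
begin

lemma mem_range: "(r, c, s) \<in> L \<Longrightarrow> r \<in> {1..n} \<and> c \<in> {1..n} \<and> s \<in> {1..n}"
  using latin unfolding latin_square_iff by blast

lemma symbol_unique: "(r, c, s) \<in> L \<Longrightarrow> (r, c, s') \<in> L \<Longrightarrow> s = s'"
  using latin_squareD(1)[OF latin] by blast

lemma column_unique: "(r, c, s) \<in> L \<Longrightarrow> (r, c', s) \<in> L \<Longrightarrow> c = c'"
  using latin_squareD(2)[OF latin] by blast

text \<open>By counting: the \<open>n\<^sup>2\<close> triples lie in distinct cells, and there are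
  only \<open>n\<^sup>2\<close> cells, so every cell is filled.\<close>

lemma symbol_exists:
  assumes "r \<in> {1..n}" "c \<in> {1..n}"
  shows "\<exists>s. (r, c, s) \<in> L"
proof -
  let ?cell = "\<lambda>(r, c, s). (r, c) :: nat \<times> nat"
  have "inj_on ?cell L"
    using symbol_unique by (auto simp: inj_on_def)
  then have "card (?cell ` L) = card ({1..n} \<times> {1..n})"
    using latin by (simp add: card_image latin_square_iff power2_eq_square)
  moreover have "?cell ` L \<subseteq> {1..n} \<times> {1..n}"
    using mem_range by fastforce
  ultimately have "?cell ` L = {1..n} \<times> {1..n}"
    by (intro card_subset_eq) auto
  then have "(r, c) \<in> ?cell ` L" using assms by blast
  then show ?thesis by auto
qed

text \<open>The value \<open>c\<close> outside \<open>{1..n}\<close> makes a row a permutation in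
  the sense of \<open>permutes\<close>, so that it can be inverted and composed with the components
  of isotopisms.\<close>

definition row :: "nat \<Rightarrow> nat \<Rightarrow> nat" where
  "row r c = (if c \<in> {1..n} then THE s. (r, c, s) \<in> L else c)"

lemma row_outside: "c \<notin> {1..n} \<Longrightarrow> row r c = c"
  by (simp only: row_def if_False)

lemma row_mem:
  assumes "r \<in> {1..n}" "c \<in> {1..n}"
  shows "(r, c, row r c) \<in> L"
proof -
  have "\<exists>!s. (r, c, s) \<in> L"
    using symbol_exists[OF assms] symbol_unique by blast
  from theI'[OF this] show ?thesis
    using assms(2) by (simp only: row_def if_True)
qed

lemma row_permutes: "r \<in> {1..n} \<Longrightarrow> row r permutes {1..n}"
proof (rule inj_imp_permutes)
  assume r: "r \<in> {1..n}"
  show "inj_on (row r) {1..n}"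
    using row_mem[OF r] column_unique by (metis inj_onI)
  show "row r c \<in> {1..n}" if "c \<in> {1..n}" for c
    using row_mem[OF r that] mem_range by blast
qed (auto simp: row_def)

definition loop :: "nat \<Rightarrow> triple set" where
  "loop e = apply_isotopism (id, id, inv (row e)) L"

lemma latin_square_loop: "e \<in> {1..n} \<Longrightarrow> latin_square n (loop e)"
  unfolding loop_def by (intro latin_square_apply_isotopism latin permutes_id permutes_inv row_permutes)

text \<open>Relabelling symbols by the inverse of row \<open>e\<close> turns that row into the
  identity. By symmetry column \<open>e\<close> of \<open>L\<close> is the same as row
  \<open>e\<close>, so the same relabelling makes \<open>e\<close> a two-sided identity
  element.\<close>

lemma loop_unit:
  assumes "e \<in> {1..n}" "i \<in> {1..n}"
  shows "(e, i, i) \<in> loop e" "(i, e, i) \<in> loop e"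
proof -
  have L: "(e, i, row e i) \<in> L" "(i, e, row e i) \<in> L"
    using row_mem[OF assms] symm unfolding symmetric_square_iff by blast+
  have "inv (row e) (row e i) = i"
    using permutes_inverses(2)[OF row_permutes[OF assms(1)]] .
  then show "(e, i, i) \<in> loop e" "(i, e, i) \<in> loop e"
    using apply_isotopism_memI[OF L(1), of id id "inv (row e)"]
      apply_isotopism_memI[OF L(2), of id id "inv (row e)"]
    by (simp_all add: loop_def)
qed

lemma apply_loop:
  "apply_isotopism (\<alpha>, \<alpha>, \<gamma>) (loop e) = apply_isotopism (\<alpha>, \<alpha>, \<gamma> \<circ> inv (row e)) L"
  by (simp add: loop_def apply_isotopism_comp)

text \<open>The symbol in cell \<open>(\<alpha> e, \<alpha> i)\<close> can be read in two ways: as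
  the image of the symbol in cell \<open>(e, i)\<close>, and directly from row
  \<open>\<alpha> e\<close>. The equation lets \<alpha> determine \<beta>, and makes them conjugate
  when \<alpha> fixes \<open>e\<close>.\<close>

lemma isotopism_eq_row_conj:
  assumes \<alpha>: "\<alpha> permutes {1..n}" and \<beta>: "\<beta> permutes {1..n}"
    and e: "e \<in> {1..n}" and L: "apply_isotopism (\<alpha>, \<alpha>, \<beta>) L = L"
  shows "\<beta> \<circ> row e = row (\<alpha> e) \<circ> \<alpha>"
proof
  fix i
  show "(\<beta> \<circ> row e) i = (row (\<alpha> e) \<circ> \<alpha>) i"
  proof (cases "i \<in> {1..n}")
    case True
    have "(\<alpha> e, \<alpha> i, \<beta> (row e i)) \<in> L"
      using apply_isotopism_memI[OF row_mem[OF e True]] L by metis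
    moreover have "(\<alpha> e, \<alpha> i, row (\<alpha> e) (\<alpha> i)) \<in> L"
      using e True \<alpha> by (intro row_mem) (simp_all only: permutes_in_image)
    ultimately show ?thesis using symbol_unique by simp
  next
    case False
    then show ?thesis
      using permutes_not_in[OF \<alpha>] permutes_not_in[OF \<beta>] by (metis comp_apply row_outside)
  qed
qed

section \<open>Reduced squares, isomorphic loops and isomorphism classes\<close>

text \<open>Row 1 of the image comes from row \<open>e\<close> of \<open>L\<close>, where
  \<open>\<alpha> e = 1\<close>. Being reduced forces this row to be the identity, that is
  \<open>\<beta> \<circ> row e = \<alpha>\<close>, which is what \<open>apply_loop\<close>
  needs.\<close>

lemma reduced_rrs_isotope_eq_apply_loop:
  assumes \<alpha>: "\<alpha> permutes {1..n}" and \<beta>: "\<beta> permutes {1..n}" and n: "1 \<in> {1..n}"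
    and red: "reduced_square n (apply_isotopism (\<alpha>, \<alpha>, \<beta>) L)"
  shows "apply_isotopism (\<alpha>, \<alpha>, \<beta>) L = apply_isotopism (\<alpha>, \<alpha>, \<alpha>) (loop (inv \<alpha> 1))"
proof -
  define e where "e = inv \<alpha> 1"
  have e: "e \<in> {1..n}" "\<alpha> e = 1"
    using n permutes_in_image[OF permutes_inv[OF \<alpha>]] permutes_inverses(1)[OF \<alpha>]
    by (auto simp: e_def)
  have M: "latin_square n (apply_isotopism (\<alpha>, \<alpha>, \<beta>) L)"
    using latin \<alpha> \<beta> by (intro latin_square_apply_isotopism)
  have "(\<beta> \<circ> row e) i = \<alpha> i" for i
  proof (cases "i \<in> {1..n}")
    case True
    have "(1, \<alpha> i, \<beta> (row e i)) \<in> apply_isotopism (\<alpha>, \<alpha>, \<beta>) L"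
      using apply_isotopism_memI[OF row_mem[OF e(1) True]] e(2) by metis
    moreover have "(1, \<alpha> i, \<alpha> i) \<in> apply_isotopism (\<alpha>, \<alpha>, \<beta>) L"
      using red True permutes_in_image[OF \<alpha>] unfolding reduced_square_def by blast
    ultimately show ?thesis
      using latin_squareD(1)[OF M] by simp
  next
    case False
    then show ?thesis
      using permutes_not_in[OF \<alpha>] permutes_not_in[OF \<beta>] by (metis comp_apply row_outside)
  qed
  then have "\<alpha> = \<beta> \<circ> row e" by auto
  then have "\<alpha> \<circ> inv (row e) = \<beta>"
    using permutes_inv_o(1)[OF row_permutes[OF e(1)]] by (simp add: comp_assoc)
  then show ?thesis by (simp only: apply_loop flip: e_def)
qed

abbreviation \<Gamma> :: "perm3 set" where "\<Gamma> \<equiv> rrs_autotopism_group n L"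

lemma mem_\<Gamma>_iff:
  "(\<alpha>, \<alpha>', \<beta>) \<in> \<Gamma> \<longleftrightarrow> \<alpha>' = \<alpha> \<and> \<alpha> permutes {1..n} \<and> \<beta> permutes {1..n} \<and>
    apply_isotopism (\<alpha>, \<alpha>, \<beta>) L = L"
  by (auto simp: rrs_autotopism_group_def rrs_isotopisms_def isotopisms_def)

lemma loop_isomorphic_iff:
  assumes e: "e \<in> {1..n}" and f: "f \<in> {1..n}"
  shows "(loop e, loop f) \<in> isomorphism_rel n \<longleftrightarrow> (\<exists>\<alpha> \<in> fst ` \<Gamma>. \<alpha> e = f)"
proof
  assume "(loop e, loop f) \<in> isomorphism_rel n"
  then obtain \<alpha> where \<alpha>: "\<alpha> permutes {1..n}"
    and iso: "apply_isotopism (\<alpha>, \<alpha>, \<alpha>) (loop e) = loop f"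
    by (auto simp: isomorphism_rel_iff)
  \<comment> \<open>An isomorphism preserves the identity element: the next two triples agree in
    column and symbol, hence in row.\<close>
  have "(\<alpha> e, \<alpha> e, \<alpha> e) \<in> loop f"
    using apply_isotopism_memI[OF loop_unit(1)[OF e e]] iso by metis
  moreover have "(f, \<alpha> e, \<alpha> e) \<in> loop f"
    using loop_unit(1)[OF f] permutes_in_image[OF \<alpha>] e by blast
  ultimately have \<alpha>e: "\<alpha> e = f"
    using latin_squareD(3)[OF latin_square_loop[OF f]] by blast
  \<comment> \<open>The symbol map is that of the composite from \<open>L\<close> to
    \<open>loop e\<close>, then by \<alpha> to \<open>loop f\<close>, then back to
    \<open>L\<close>.\<close>
  let ?\<beta> = "row f \<circ> (\<alpha> \<circ> inv (row e))"
  have "apply_isotopism (\<alpha>, \<alpha>, ?\<beta>) L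
      = apply_isotopism (id, id, row f) (apply_isotopism (\<alpha>, \<alpha>, \<alpha>) (loop e))"
    by (simp add: apply_loop apply_isotopism_comp)
  also have "\<dots> = L"
    unfolding iso
    by (simp add: loop_def apply_isotopism_comp permutes_inv_o(1)[OF row_permutes[OF f]])
  finally have "(\<alpha>, \<alpha>, ?\<beta>) \<in> \<Gamma>"
    using \<alpha> row_permutes e f by (simp add: mem_\<Gamma>_iff permutes_compose permutes_inv)
  with \<alpha>e show "\<exists>\<alpha> \<in> fst ` \<Gamma>. \<alpha> e = f" by force
next
  assume "\<exists>\<alpha> \<in> fst ` \<Gamma>. \<alpha> e = f"
  then obtain \<alpha> \<beta> where \<alpha>: "\<alpha> permutes {1..n}" and \<beta>: "\<beta> permutes {1..n}"
    and L: "apply_isotopism (\<alpha>, \<alpha>, \<beta>) L = L" and \<alpha>e: "\<alpha> e = f"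
    by (auto simp: mem_\<Gamma>_iff)
  have row: "\<beta> \<circ> row e = row f \<circ> \<alpha>"
    using isotopism_eq_row_conj[OF \<alpha> \<beta> e L] \<alpha>e by simp
  \<comment> \<open>Solving the row equation for \<open>\<alpha> \<circ> inv (row e)\<close> lets
    \<alpha> on \<open>loop e\<close> be replaced by the autotopism on \<open>L\<close> followed by
    the relabelling that defines \<open>loop f\<close>.\<close>
  have "\<alpha> \<circ> inv (row e) = inv (row f) \<circ> (row f \<circ> \<alpha>) \<circ> inv (row e)"
    using permutes_inv_o(2)[OF row_permutes[OF f]] by (simp flip: o_assoc add: o_assoc[of _ _ \<alpha>])
  also have "\<dots> = inv (row f) \<circ> \<beta>"
    using permutes_inv_o(1)[OF row_permutes[OF e]] by (simp add: comp_assoc flip: row)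
  finally have "apply_isotopism (\<alpha>, \<alpha>, \<alpha>) (loop e)
      = apply_isotopism (id, id, inv (row f)) (apply_isotopism (\<alpha>, \<alpha>, \<beta>) L)"
    by (simp add: apply_loop apply_isotopism_comp)
  also have "\<dots> = loop f" by (simp only: L loop_def)
  finally show "(loop e, loop f) \<in> isomorphism_rel n"
    using \<alpha> latin_square_loop[OF e] by (auto simp: isomorphism_rel_iff)
qed

lemma classes_eq_loop_classes:
  assumes n: "1 \<in> {1..n}"
  shows "{C \<in> isomorphism_classes n.
      \<exists>M \<in> C. reduced_square n M \<and> symmetric_square M \<and> rrs_isotopic n L M}
    = (\<lambda>e. isomorphism_rel n `` {loop e}) ` {1..n}" (is "?K = ?R")
proof (intro equalityI subsetI)
  fix C assume "C \<in> ?K"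
  then obtain M where C: "C \<in> {L. latin_square n L} // isomorphism_rel n" and M: "M \<in> C"
    and red: "reduced_square n M" and iso: "rrs_isotopic n L M"
    by (auto simp: isomorphism_classes_def)
  from iso obtain \<alpha> \<beta> where \<alpha>: "\<alpha> permutes {1..n}" and \<beta>: "\<beta> permutes {1..n}"
    and M_eq: "M = apply_isotopism (\<alpha>, \<alpha>, \<beta>) L"
    by (auto simp: rrs_isotopic_def rrs_isotopisms_def isotopisms_def)
  define e where "e = inv \<alpha> 1"
  have e: "e \<in> {1..n}"
    using n permutes_in_image[OF permutes_inv[OF \<alpha>]] by (simp only: e_def)
  have "(loop e, M) \<in> isomorphism_rel n"
    using reduced_rrs_isotope_eq_apply_loop[OF \<alpha> \<beta> n] red M_eq \<alpha> latin_square_loop[OF e]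
    by (metis e_def isomorphism_rel_iff)
  moreover have "C = isomorphism_rel n `` {M}"
    using C M equiv_isomorphism_rel by (metis Image_singleton_iff equiv_class_eq quotientE)
  ultimately have "C = isomorphism_rel n `` {loop e}"
    using equiv_class_eq[OF equiv_isomorphism_rel] by metis
  with e show "C \<in> ?R" by blast
next
  fix C assume "C \<in> ?R"
  then obtain e where e: "e \<in> {1..n}" and C: "C = isomorphism_rel n `` {loop e}" by blast
  \<comment> \<open>Swapping 1 and \<open>e\<close> moves the identity element to 1, so the square
    becomes reduced without leaving its isomorphism class.\<close>
  let ?\<tau> = "Transposition.transpose 1 e"
  let ?M = "apply_isotopism (?\<tau>, ?\<tau>, ?\<tau>) (loop e)"
  have \<tau>: "?\<tau> permutes {1..n}" using n e by (rule permutes_swap_id)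
  have "(1, i, i) \<in> ?M \<and> (i, 1, i) \<in> ?M" if "i \<in> {1..n}" for i
  proof -
    have "?\<tau> i \<in> {1..n}" using that permutes_in_image[OF \<tau>] by blast
    from apply_isotopism_memI[OF loop_unit(1)[OF e this], of ?\<tau> ?\<tau> ?\<tau>]
      apply_isotopism_memI[OF loop_unit(2)[OF e this], of ?\<tau> ?\<tau> ?\<tau>]
    show ?thesis by simp
  qed
  then have "reduced_square n ?M" by (simp only: reduced_square_def) blast
  moreover have "symmetric_square ?M"
    using symm by (simp only: loop_def symmetric_square_apply_isotopism)
  moreover have "rrs_isotopic n L ?M"
  proof -
    have "(?\<tau>, ?\<tau>, ?\<tau> \<circ> inv (row e)) \<in> rrs_isotopisms n"
      using \<tau> row_permutes[OF e]
      by (auto simp: rrs_isotopisms_def isotopisms_def permutes_compose permutes_inv)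
    then show ?thesis unfolding rrs_isotopic_def apply_loop by blast
  qed
  moreover have "?M \<in> C"
    using C \<tau> latin_square_loop[OF e]
    by (auto simp: isomorphism_rel_iff)
  moreover have "C \<in> isomorphism_classes n"
    using C latin_square_loop[OF e] by (auto simp: isomorphism_classes_def intro: quotientI)
  ultimately show "C \<in> ?K" by blast
qed

section \<open>Orbits of \<Gamma> and the final count\<close>

lemma lambda_count_eq_card_fixed_points:
  assumes "(\<alpha>, \<alpha>', \<beta>) \<in> \<Gamma>"
  shows "lambda_count n \<alpha> \<beta> = card {i \<in> {1..n}. \<alpha> i = i}"
proof (cases "\<exists>e \<in> {1..n}. \<alpha> e = e")
  case True
  then obtain e where e: "e \<in> {1..n}" "\<alpha> e = e" by blast
  have \<alpha>: "\<alpha> permutes {1..n}" using assms by (simp add: mem_\<Gamma>_iff)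
  have "\<beta> \<circ> row e = row e \<circ> \<alpha>"
    using isotopism_eq_row_conj[of \<alpha> \<beta> e] assms e by (simp add: mem_\<Gamma>_iff)
  then have "cycle_structure n \<beta> = cycle_structure n \<alpha>"
    by (rule cycle_structure_conj[OF row_permutes[OF e(1)] \<alpha>])
  then show ?thesis by (simp add: lambda_count_def)
next
  case False
  \<comment> \<open>Without fixed points both branches of \<open>lambda_count\<close> give 0,
    whatever the cycle structures are.\<close>
  then have "{i \<in> {1..n}. \<alpha> i = i} = {}" by blast
  then show ?thesis by (simp add: lambda_count_def)
qed

text \<open>\<beta> is determined on the image of row 1, which is everything. Hence sums over
  \<Gamma> and over its first components can be exchanged.\<close>

lemma inj_on_fst_\<Gamma>:
  assumes n: "1 \<in> {1..n}"
  shows "inj_on fst \<Gamma>"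
proof -
  have "\<beta> = \<beta>'" if "(\<alpha>, \<alpha>, \<beta>) \<in> \<Gamma>" "(\<alpha>, \<alpha>, \<beta>') \<in> \<Gamma>" for \<alpha> \<beta> \<beta>'
  proof -
    have "\<beta> \<circ> row 1 = \<beta>' \<circ> row 1"
      using that isotopism_eq_row_conj[OF _ _ n] unfolding mem_\<Gamma>_iff by metis
    then show ?thesis
      using permutes_surj[OF row_permutes[OF n]] by (metis comp_apply ext surjD)
  qed
  then show ?thesis
    by (auto simp: inj_on_def) (metis mem_\<Gamma>_iff)+
qed

lemma card_orbits_mult_card_\<Gamma>:
  assumes n: "1 \<in> {1..n}"
  shows "card ((\<lambda>e. (\<lambda>\<alpha>. \<alpha> e) ` fst ` \<Gamma>) ` {1..n}) * card \<Gamma>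
    = (\<Sum>(\<alpha>, \<alpha>', \<beta>)\<in>\<Gamma>. lambda_count n \<alpha> \<beta>)"
proof -
  let ?A = "fst ` \<Gamma>"
  have A_iff: "\<alpha> \<in> ?A \<longleftrightarrow> (\<exists>\<beta>. \<alpha> permutes {1..n} \<and> \<beta> permutes {1..n} \<and>
      apply_isotopism (\<alpha>, \<alpha>, \<beta>) L = L)" for \<alpha>
    by (simp add: image_iff Bex_def mem_\<Gamma>_iff)
  have "card ((\<lambda>e. (\<lambda>\<alpha>. \<alpha> e) ` ?A) ` {1..n}) * card ?A = (\<Sum>\<alpha>\<in>?A. card {i \<in> {1..n}. \<alpha> i = i})"
  proof (rule burnside_permutations)
    show "id \<in> ?A" unfolding A_iff using permutes_id apply_isotopism_id by blast
    show "a \<circ> b \<in> ?A" if ab: "a \<in> ?A" "b \<in> ?A" for a b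
    proof -
      obtain a' b' where a: "a permutes {1..n}" "a' permutes {1..n}" "apply_isotopism (a, a, a') L = L"
        and b: "b permutes {1..n}" "b' permutes {1..n}" "apply_isotopism (b, b, b') L = L"
        using ab unfolding A_iff by blast
      have "apply_isotopism (a \<circ> b, a \<circ> b, a' \<circ> b') L = L"
        using a(3) b(3) by (simp flip: apply_isotopism_comp)
      with a b show ?thesis unfolding A_iff by (blast intro: permutes_compose)
    qed
    show "inv a \<in> ?A" if "a \<in> ?A" for a
    proof -
      obtain a' where a: "a permutes {1..n}" "a' permutes {1..n}" "apply_isotopism (a, a, a') L = L"
        using \<open>a \<in> ?A\<close> unfolding A_iff by blast
      have "apply_isotopism (inv a, inv a, inv a') L = L"
        using a(3) unfolding apply_isotopism_eq_iff[OF a(1) a(1) a(2)] by (rule sym)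
      with a show ?thesis unfolding A_iff by (blast intro: permutes_inv)
    qed
    show "a permutes {1..n}" if "a \<in> ?A" for a
      using that unfolding A_iff by blast
  qed simp
  also have "\<dots> = (\<Sum>\<theta>\<in>\<Gamma>. card {i \<in> {1..n}. fst \<theta> i = i})"
    using sum.reindex[OF inj_on_fst_\<Gamma>[OF n]] by (simp add: o_def)
  also have "\<dots> = (\<Sum>(\<alpha>, \<alpha>', \<beta>)\<in>\<Gamma>. lambda_count n \<alpha> \<beta>)"
    by (intro sum.cong refl) (auto simp: lambda_count_eq_card_fixed_points)
  finally show ?thesis
    by (simp only: card_image[OF inj_on_fst_\<Gamma>[OF n]])
qed

text \<open>Permits the final division by the group order.\<close>

lemma card_\<Gamma>_pos: "card \<Gamma> > 0"
proof -
  have "\<Gamma> \<subseteq> {p. p permutes {1..n}} \<times> {p. p permutes {1..n}} \<times> {p. p permutes {1..n}}"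
    using mem_\<Gamma>_iff by auto
  then have "finite \<Gamma>"
    by (rule finite_subset) (auto intro: finite_permutations)
  moreover have "(id, id, id) \<in> \<Gamma>"
    using mem_\<Gamma>_iff permutes_id apply_isotopism_id by blast
  ultimately show ?thesis by (auto simp: card_gt_0_iff)
qed

lemma card_classes_eq_card_orbits:
  assumes n: "1 \<in> {1..n}"
  shows "card {C \<in> isomorphism_classes n.
      \<exists>M \<in> C. reduced_square n M \<and> symmetric_square M \<and> rrs_isotopic n L M}
    = card ((\<lambda>e. (\<lambda>\<alpha>. \<alpha> e) ` fst ` \<Gamma>) ` {1..n})"
  unfolding classes_eq_loop_classes[OF n]
proof (rule card_image_eq_if_same_kernel)
  let ?R = "isomorphism_rel n" and ?orb = "\<lambda>e. (\<lambda>\<alpha>. \<alpha> e) ` fst ` \<Gamma>"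
  fix e f assume ef: "e \<in> {1..n}" "f \<in> {1..n}"
  have class_iff: "?R `` {loop x} = ?R `` {loop y} \<longleftrightarrow> y \<in> ?orb x"
    if "x \<in> {1..n}" "y \<in> {1..n}" for x y
    using that eq_equiv_class_iff[OF equiv_isomorphism_rel] latin_square_loop loop_isomorphic_iff
    by (auto simp: image_iff)
  have orb_sub: "?orb x \<subseteq> {1..n}" if "x \<in> {1..n}" for x
    using that permutes_in_image by (force simp: mem_\<Gamma>_iff)
  show "?R `` {loop e} = ?R `` {loop f} \<longleftrightarrow> ?orb e = ?orb f"
  proof
    assume eq: "?R `` {loop e} = ?R `` {loop f}"
    \<comment> \<open>By \<open>class_iff\<close>, membership in an orbit is equality of classes, so
      orbits inherit their partition property from the isomorphism relation.\<close>
    have "y \<in> ?orb e \<longleftrightarrow> y \<in> ?orb f" if "y \<in> {1..n}" for y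
      by (simp only: eq that ef flip: class_iff)
    then show "?orb e = ?orb f"
      using orb_sub[OF ef(1)] orb_sub[OF ef(2)] by blast
  next
    assume "?orb e = ?orb f"
    moreover have "f \<in> ?orb f" using class_iff ef by blast
    ultimately show "?R `` {loop e} = ?R `` {loop f}" using class_iff ef by blast
  qed
qed

end

theorem theorem6:
  fixes n :: nat and L :: "triple set" and \<Gamma> :: "perm3 set"
  assumes "n \<ge> 1"
    and "latin_square n L"
    and "symmetric_square L"
    and "\<Gamma> = rrs_autotopism_group n L"
  shows "real (card {C \<in> isomorphism_classes n.
           \<exists>M \<in> C. reduced_square n M \<and> symmetric_square M \<and> rrs_isotopic n L M})
         = 1 / real (card \<Gamma>) * (\<Sum>(\<alpha>, \<alpha>', \<beta>) \<in> \<Gamma>. real (lambda_count n \<alpha> \<beta>))"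
proof -
  interpret symmetric_latin_square n L
    using assms by unfold_locales
  have n: "1 \<in> {1..n}" using assms(1) by simp
  have "real (card {C \<in> isomorphism_classes n.
      \<exists>M \<in> C. reduced_square n M \<and> symmetric_square M \<and> rrs_isotopic n L M}) * real (card \<Gamma>)
    = (\<Sum>(\<alpha>, \<alpha>', \<beta>) \<in> \<Gamma>. real (lambda_count n \<alpha> \<beta>))"
    using arg_cong[OF card_orbits_mult_card_\<Gamma>[OF n], of real]
    unfolding assms(4) card_classes_eq_card_orbits[OF n] by (simp add: case_prod_beta)
  then show ?thesis
    using card_\<Gamma>_pos assms(4) by (simp add: field_simps)
qed

end
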